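(* For every odd positive integer $n$, the only regular Steinhaus graph on $n$ vertices whose Steinhaus matrix is multi-symmetric is the zero-edge graph on $n$ vertices.
   Context: A Steinhaus matrix of size $n\geq1$ is a matrix $M=(a_{i,j})_{1\leq i,j\leq n}$ with entries in $\mathbb{F}_2=\{0,1\}$ such that $a_{i,i}=0$ for all $i$, $a_{i,j}=a_{i-1,j-1}+a_{i-1,j}$ (addition in $\mathbb{F}_2$) for all $2\leq i<j\leq n$, and $a_{i,j}=a_{j,i}$ for all $i,j$. A Steinhaus graph is a simple graph on labelled vertices $V_1,\ldots,V_n$ whose adjacency matrix is a Steinhaus matrix (its Steinhaus matrix). A square matrix $(a_{i,j})$ of size $n$ is doubly-symmetric if $a_{i,j}=a_{j,i}=a_{n-j+1,n-i+1}$ for all $i,j$; it is multi-symmetric if it is doubly-symmetric and $a_{i,j}=a_{i,n-j+i+1}$ for all $1\leq i<j\leq n$. *)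

theory Defs
  imports "HOL-Library.Z2" "Jordan_Normal_Form.Matrix" "Graph_Theory.Pair_Digraph"
begin

text \<open>
  Library matrices are indexed from 0; all indices below range over \<open>{1..n}\<close>,
  with \<open>entry M i j\<close> the entry in row \<open>i\<close> and column \<open>j\<close>. The field with two
  elements is the type \<open>bit\<close>.
\<close>

definition entry :: "'a mat \<Rightarrow> nat \<Rightarrow> nat \<Rightarrow> 'a" where
  "entry M i j = M $$ (i - 1, j - 1)"

definition steinhaus_matrix :: "nat \<Rightarrow> bit mat \<Rightarrow> bool" where
  "steinhaus_matrix n M \<longleftrightarrow>
     M \<in> carrier_mat n n \<and>
     (\<forall>i\<in>{1..n}. entry M i i = 0) \<and>
     (\<forall>i j. 2 \<le> i \<and> i < j \<and> j \<le> n \<longrightarrow>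
        entry M i j = entry M (i - 1) (j - 1) + entry M (i - 1) j) \<and>
     (\<forall>i\<in>{1..n}. \<forall>j\<in>{1..n}. entry M i j = entry M j i)"

definition doubly_symmetric :: "nat \<Rightarrow> 'a mat \<Rightarrow> bool" where
  "doubly_symmetric n M \<longleftrightarrow>
     M \<in> carrier_mat n n \<and>
     (\<forall>i\<in>{1..n}. \<forall>j\<in>{1..n}.
        entry M i j = entry M j i \<and>
        entry M j i = entry M (n - j + 1) (n - i + 1))"

definition multi_symmetric :: "nat \<Rightarrow> 'a mat \<Rightarrow> bool" where
  "multi_symmetric n M \<longleftrightarrow>
     doubly_symmetric n M \<and>
     (\<forall>i j. 1 \<le> i \<and> i < j \<and> j \<le> n \<longrightarrow> entry M i j = entry M i (n - j + i + 1))"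

text \<open>
  A simple graph is a \<open>pair_graph\<close>: a finite loop-free digraph without parallel arcs whose
  arc set is symmetric, each edge being given by its two opposite arcs. The vertex
  \<open>V\<^sub>i\<close> is represented by its label \<open>i\<close>.
\<close>

definition adjacency_matrix :: "nat \<Rightarrow> nat pair_pre_digraph \<Rightarrow> bit mat" where
  "adjacency_matrix n G = mat n n (\<lambda>(i, j). if (i + 1, j + 1) \<in> parcs G then 1 else 0)"

definition steinhaus_graph :: "nat \<Rightarrow> nat pair_pre_digraph \<Rightarrow> bool" where
  "steinhaus_graph n G \<longleftrightarrow>
     pair_graph G \<and> pverts G = {1..n} \<and> steinhaus_matrix n (adjacency_matrix n G)"

text \<open>In a symmetric digraph the degree of the underlying simple graph is the out-degree.\<close>

definition regular_graph :: "'a pair_pre_digraph \<Rightarrow> bool" where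
  "regular_graph G \<longleftrightarrow> (\<exists>d. \<forall>v\<in>pverts G. out_degree (with_proj G) v = d)"

definition zero_edge_graph :: "nat \<Rightarrow> nat pair_pre_digraph" where
  "zero_edge_graph n = \<lparr>pverts = {1..n}, parcs = {}\<rparr>"

end

theory Submission
  imports Defs
begin

text \<open>
  Write \<open>R\<^sub>i\<close> for the number of ones in row \<open>i\<close> of the upper triangle, so that
  \<open>V\<^sub>i\<close> has degree \<open>R\<^sub>i + R\<^sub>n\<^sub>+\<^sub>1\<^sub>-\<^sub>i\<close>. For odd \<open>i\<close> the row is a palindrome of even length, and
  modulo 2 its half sum telescopes to \<open>a\<^sub>1\<^sub>,\<^sub>i\<close> (rows of odd length have a zero in the middle).
  Hence regularity modulo 4 makes \<open>a\<^sub>1\<^sub>,\<^sub>i + a\<^sub>1\<^sub>,\<^sub>i\<^sub>+\<^sub>1 = a\<^sub>2\<^sub>,\<^sub>i\<^sub>+\<^sub>1\<close> constant for odd \<open>i \<ge> 3\<close>; the symmetries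
  force the constant to be 0, and then all entries with both indices even vanish.

  So the even vertices are independent. Counting degrees over the \<open>(n - 1) / 2\<close> even and the
  \<open>(n + 1) / 2\<close> odd vertices, the degrees inside the odd part add up to the common degree \<open>d\<close>.
  But \<open>V\<^sub>1\<close> and \<open>V\<^sub>n\<close> each have \<open>d / 2\<close> odd neighbours and are not adjacent, which accounts for
  \<open>2 d\<close> of that sum, so \<open>d = 0\<close>.
\<close>

section \<open>Bits read as natural numbers, for counting ones, and finite sums\<close>

definition bval :: "bit \<Rightarrow> nat" where
  "bval x = (if x = 1 then 1 else 0)"

lemma of_nat_bval [simp]: "(of_nat (bval x) :: bit) = x"
  by (cases x) (auto simp: bval_def)

lemma bval_eq_0_iff [simp]: "bval x = 0 \<longleftrightarrow> x = 0"
  by (cases x) (auto simp: bval_def)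

lemma bval_0 [simp]: "bval 0 = 0"
  by simp

lemma bit_add_self [simp]: "(x :: bit) + x = 0"
  by (cases x) auto

text \<open>Keeps sums of bits written with \<open>+\<close>, the form in which the recurrence and
  the cancellation rules match.\<close>

declare add_bit_eq_xor [simp del]

lemma bit_add_left_self: "(x :: bit) + (x + y) = y"
  by (simp flip: add.assoc)

lemma bit_add_eq_0_iff: "(x :: bit) + y = 0 \<longleftrightarrow> x = y"
  by (cases x; cases y) auto

lemma sum_palindrome_double:
  fixes g :: "nat \<Rightarrow> nat"
  assumes "\<And>t. t < 2 * p \<Longrightarrow> g t = g (2 * p - 1 - t)"
  shows "(\<Sum>t<2 * p. g t) = 2 * (\<Sum>t<p. g t)"
proof -
  have "(\<Sum>t=p..<2 * p. g t) = (\<Sum>t<p. g t)"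
  proof (rule sum.reindex_bij_witness[of _ "\<lambda>t. 2 * p - 1 - t" "\<lambda>t. 2 * p - 1 - t"])
    fix t assume "t \<in> {p..<2 * p}"
    then show "g (2 * p - 1 - t) = g t"
      by (intro assms[symmetric]) simp
  qed auto
  moreover have "{..<2 * p} = {..<p} \<union> {p..<2 * p}"
    by auto
  moreover have "sum g ({..<p} \<union> {p..<2 * p}) = sum g {..<p} + sum g {p..<2 * p}"
    by (rule sum.union_disjoint) auto
  ultimately show ?thesis
    by simp
qed

lemma sum_odd_even_split:
  fixes f :: "nat \<Rightarrow> 'a :: comm_monoid_add"
  shows "(\<Sum>j=1..n. f j) = (\<Sum>j\<in>{j\<in>{1..n}. odd j}. f j) + (\<Sum>j\<in>{j\<in>{1..n}. even j}. f j)"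
proof -
  have split: "{1..n} = {j\<in>{1..n}. odd j} \<union> {j\<in>{1..n}. even j}"
    by auto
  show ?thesis
    by (subst split, rule sum.union_disjoint) auto
qed

lemma sum_telescope_bit:
  "(\<Sum>t<p. b t + b (Suc t)) = b 0 + (b p :: bit)"
proof (induction p)
  case (Suc p)
  then show ?case
    by (simp add: add_ac)
qed simp

section \<open>Multi-symmetric Steinhaus matrices of odd size and their reflections\<close>

locale multi_symmetric_steinhaus =
  fixes n :: nat and a :: "nat \<Rightarrow> nat \<Rightarrow> bit"
  assumes odd_n: "odd n"
    and diag: "\<And>i. 1 \<le> i \<Longrightarrow> i \<le> n \<Longrightarrow> a i i = 0"
    and rec: "\<And>i j. 2 \<le> i \<Longrightarrow> i < j \<Longrightarrow> j \<le> n \<Longrightarrow> a i j = a (i - 1) (j - 1) + a (i - 1) j"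
    and symm: "\<And>i j. 1 \<le> i \<Longrightarrow> i \<le> n \<Longrightarrow> 1 \<le> j \<Longrightarrow> j \<le> n \<Longrightarrow> a i j = a j i"
    and anti: "\<And>i j. 1 \<le> i \<Longrightarrow> i \<le> n \<Longrightarrow> 1 \<le> j \<Longrightarrow> j \<le> n \<Longrightarrow> a j i = a (n - j + 1) (n - i + 1)"
    and row_symm: "\<And>i j. 1 \<le> i \<Longrightarrow> i < j \<Longrightarrow> j \<le> n \<Longrightarrow> a i j = a i (n - j + i + 1)"
begin

lemma anti_upper:
  assumes "1 \<le> i" "i \<le> n" "1 \<le> j" "j \<le> n"
  shows "a i j = a (n + 1 - j) (n + 1 - i)"
proof -
  have index: "n + 1 - j = n - j + 1" "n + 1 - i = n - i + 1"
    using assms by auto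
  have "a i j = a j i"
    by (rule symm) (use assms in auto)
  also have "\<dots> = a (n + 1 - j) (n + 1 - i)"
    unfolding index by (rule anti) (use assms in auto)
  finally show ?thesis .
qed

text \<open>Applying the recurrence twice produces the middle term two times, and it cancels in
  characteristic 2. The double step preserves the parity of both indices.\<close>

lemma rec2:
  assumes "3 \<le> i" "i < j" "j \<le> n"
  shows "a i j = a (i - 2) (j - 2) + a (i - 2) j"
proof -
  have sub2: "i - 1 - 1 = i - 2" "j - 1 - 1 = j - 2"
    by auto
  have "a i j = a (i - 1) (j - 1) + a (i - 1) j"
    by (rule rec) (use assms in auto)
  also have "a (i - 1) (j - 1) = a (i - 1 - 1) (j - 1 - 1) + a (i - 1 - 1) (j - 1)"
    by (rule rec) (use assms in auto)
  also have "a (i - 1) j = a (i - 1 - 1) (j - 1) + a (i - 1 - 1) j"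
    by (rule rec) (use assms in auto)
  finally show ?thesis
    unfolding sub2 add.assoc bit_add_left_self .
qed

text \<open>By the recurrence the middle entry is a sum of two neighbours in row
  \<open>i - 1\<close>; reversing that row exchanges them, so they cancel.\<close>

lemma even_row_middle:
  assumes "even i" "2 \<le> i" "i < n"
  shows "a i ((n + i + 1) div 2) = 0"
proof -
  have "even (n + i + 1)"
    using assms(1) odd_n by simp
  then obtain m where m: "n + i + 1 = 2 * m"
    by (rule evenE)
  have index: "m - 1 = n - m + (i - 1) + 1"
    using assms m by linarith
  have "a i m = a (i - 1) (m - 1) + a (i - 1) m"
    by (rule rec) (use assms m in linarith)+
  also have "a (i - 1) m = a (i - 1) (m - 1)"
    unfolding index by (rule row_symm) (use assms m in linarith)+
  also have "m = (n + i + 1) div 2"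
    unfolding m by simp
  finally show ?thesis
    by (simp only: bit_add_self)
qed

text \<open>The antidiagonal reflection takes (1, 2) to (n - 1, n), the only entry of its row right
  of the diagonal and hence a middle entry. Reversing row 1 takes \<open>n\<close> to 2.\<close>

lemma corner:
  assumes "3 \<le> n"
  shows "a 1 2 = 0" "a 1 n = 0"
proof -
  have "a 1 2 = a (n - 1) n"
    using anti_upper[of 1 2] assms by simp
  moreover have "a (n - 1) n = 0"
    using even_row_middle[of "n - 1"] assms odd_n by simp
  ultimately show "a 1 2 = 0"
    by simp
  then show "a 1 n = 0"
    using row_symm[of 1 n] assms by (simp add: numeral_2_eq_2)
qed

section \<open>Row sums and degrees of the odd vertices\<close>

definition half_sum :: "nat \<Rightarrow> nat" where
  "half_sum k = (\<Sum>t<(n - k) div 2. bval (a k (k + 1 + t)))"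

text \<open>For odd \<open>k\<close> there are \<open>n - k\<close> entries right of the diagonal,
  an even number, so the palindrome splits into two equal halves without a middle entry.\<close>

lemma row_sum_odd:
  assumes "odd k" "k \<le> n"
  shows "(\<Sum>j\<in>{k<..n}. bval (a k j)) = 2 * half_sum k"
proof -
  have "even (n - k)"
    using assms odd_n by simp
  then obtain p where p: "n - k = 2 * p"
    by (rule evenE)
  have "(\<Sum>j\<in>{k<..n}. bval (a k j)) = (\<Sum>t<2 * p. bval (a k (k + 1 + t)))"
    by (rule sum.reindex_bij_witness[of _ "\<lambda>t. k + 1 + t" "\<lambda>j. j - k - 1"])
      (use assms p in auto)
  also have "\<dots> = 2 * (\<Sum>t<p. bval (a k (k + 1 + t)))"
  proof (rule sum_palindrome_double)
    fix t assume t: "t < 2 * p"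
    have "n - (k + 1 + t) + k + 1 = k + 1 + (2 * p - 1 - t)"
      using t p assms by auto
    then show "bval (a k (k + 1 + t)) = bval (a k (k + 1 + (2 * p - 1 - t)))"
      using row_symm[of k "k + 1 + t"] t p assms odd_pos[of k] by auto
  qed
  finally show ?thesis
    by (simp add: half_sum_def p)
qed

text \<open>Each entry of row \<open>k\<close> is a sum of two neighbours in row
  \<open>k - 1\<close>, so modulo 2 the half row telescopes to the first entry of row
  \<open>k - 1\<close> right of the diagonal plus its middle entry, which vanishes.\<close>

lemma half_sum_odd:
  assumes "odd k" "3 \<le> k" "k \<le> n"
  shows "(of_nat (half_sum k) :: bit) = a 1 k"
proof -
  have "even (n - k)"
    using assms odd_n by simp
  then obtain p where p: "n - k = 2 * p"
    by (rule evenE)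
  have "(of_nat (half_sum k) :: bit) = (\<Sum>t<p. a k (k + 1 + t))"
    by (simp add: half_sum_def p)
  also have "\<dots> = (\<Sum>t<p. a (k - 1) (k + t) + a (k - 1) (k + Suc t))"
    using assms p by (intro sum.cong) (auto simp: rec[of k])
  also have "\<dots> = a (k - 1) k + a (k - 1) (k + p)"
    using sum_telescope_bit[of "\<lambda>t. a (k - 1) (k + t)" p] by simp
  also have "(n + (k - 1) + 1) div 2 = k + p"
    using p assms by auto
  then have "a (k - 1) (k + p) = 0"
    using even_row_middle[of "k - 1"] assms by auto
  \<comment> \<open>The remaining entry is carried to row 1: reverse row \<open>k - 1\<close>,
    reflect in the antidiagonal, then reverse row 1.\<close>
  also have "a (k - 1) k = a (k - 1) n"
    using row_symm[of "k - 1" n] assms by simp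
  also have "\<dots> = a 1 (n + 2 - k)"
    using anti_upper[of "k - 1" n] assms by (simp add: Suc_diff_le)
  also have "\<dots> = a 1 k"
    using row_symm[of 1 k] assms by (simp add: Suc_diff_le)
  finally show ?thesis
    by simp
qed

text \<open>The part of row \<open>k\<close> left of the diagonal is, by symmetry and the
  antidiagonal reflection, the part of row \<open>n + 1 - k\<close> right of the diagonal; that row
  is odd as well.\<close>

lemma degree_odd:
  assumes "odd k" "1 \<le> k" "k \<le> n"
  shows "(\<Sum>j=1..n. bval (a k j)) = 2 * half_sum k + 2 * half_sum (n + 1 - k)"
proof -
  have "(\<Sum>j\<in>{1..<k}. bval (a k j)) = (\<Sum>j\<in>{n + 1 - k<..n}. bval (a (n + 1 - k) j))"
  proof (rule sum.reindex_bij_witness[of _ "\<lambda>j. n + 1 - j" "\<lambda>j. n + 1 - j"])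
    fix j assume "j \<in> {1..<k}"
    then show "bval (a (n + 1 - k) (n + 1 - j)) = bval (a k j)"
      using symm[of k j] anti_upper[of j k] assms by simp
  qed (use assms in auto)
  also have "\<dots> = 2 * half_sum (n + 1 - k)"
    by (rule row_sum_odd) (use assms odd_n in auto)
  finally have lower: "(\<Sum>j\<in>{1..<k}. bval (a k j)) = 2 * half_sum (n + 1 - k)" .
  have split: "{1..n} - {k} = {1..<k} \<union> {k<..n}"
    using assms by auto
  have rest: "(\<Sum>j\<in>{1..n} - {k}. bval (a k j)) =
      (\<Sum>j\<in>{1..<k}. bval (a k j)) + (\<Sum>j\<in>{k<..n}. bval (a k j))"
    unfolding split by (rule sum.union_disjoint) auto
  have "(\<Sum>j=1..n. bval (a k j)) = bval (a k k) + (\<Sum>j\<in>{1..n} - {k}. bval (a k j))"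
    by (rule sum.remove) (use assms in auto)
  also have "\<dots> = 2 * half_sum (n + 1 - k) + 2 * half_sum k"
    by (simp only: rest lower row_sum_odd[OF assms(1,3)] diag[OF assms(2,3)] bval_0 add_0)
  finally show ?thesis
    by (simp only: add.commute)
qed

section \<open>Regular case: independence of the even vertices\<close>

context
  fixes d :: nat
  assumes regular: "\<And>v. 1 \<le> v \<Longrightarrow> v \<le> n \<Longrightarrow> (\<Sum>j=1..n. bval (a v j)) = d"
begin

text \<open>Reduces half the degree of \<open>V_k\<close> modulo 2. The bounds on \<open>k\<close>
  say that both \<open>k\<close> and \<open>n + 1 - k\<close> are at least 3, as
  \<open>half_sum_odd\<close> requires.\<close>

lemma row2_const:
  assumes "odd k" "3 \<le> k" "k + 2 \<le> n"
  shows "a 2 (k + 1) = of_nat (d div 2)"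
proof -
  have "d = 2 * half_sum k + 2 * half_sum (n + 1 - k)"
    using degree_odd[of k] regular[of k] assms by simp
  then have "d div 2 = half_sum k + half_sum (n + 1 - k)"
    by simp
  then have "(of_nat (d div 2) :: bit) = of_nat (half_sum k) + of_nat (half_sum (n + 1 - k))"
    by (simp only: of_nat_add)
  also have "\<dots> = a 1 k + a 1 (n + 1 - k)"
    using half_sum_odd[of k] half_sum_odd[of "n + 1 - k"] assms odd_n by simp
  also have "a 1 (n + 1 - k) = a 1 (k + 1)"
  proof -
    have index: "n + 1 - k = n - (k + 1) + 1 + 1"
      using assms by simp
    show ?thesis
      unfolding index by (rule row_symm[symmetric]) (use assms in auto)
  qed
  also have "a 1 k + a 1 (k + 1) = a 2 (k + 1)"
    using rec[of 2 "k + 1"] assms by simp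
  finally show ?thesis
    by (rule sym)
qed

lemma row2_even_zero:
  assumes "even j" "4 \<le> j" "j \<le> n"
  shows "a 2 j = 0"
proof -
  \<comment> \<open>An even \<open>i\<close> differs from the odd \<open>n\<close>, so
    \<open>k = i - 1\<close> satisfies \<open>k + 2 \<le> n\<close>.\<close>
  have c: "a 2 i = of_nat (d div 2)" if "even i" "4 \<le> i" "i \<le> n" for i
    using row2_const[of "i - 1"] that odd_n by (cases "i = n") auto
  have "5 \<le> n"
    using assms odd_n by (cases "n = 4") auto
  have "(of_nat (d div 2) :: bit) = 0"
  proof (cases "n = 5")
    case True
    then show ?thesis
      \<comment> \<open>For \<open>n = 5\<close>, column 4 is the middle of row 2.\<close>
      using c[of 4] even_row_middle[of 2] by simp
  next
    case False
    with \<open>5 \<le> n\<close> odd_n have n7: "7 \<le> n"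
      by (cases "n = 6") auto
    \<comment> \<open>The reflected entry is also the sum of two entries of row 2. All three equal
      the constant \<open>c\<close>, so \<open>c = c + c = 0\<close>.\<close>
    have "a 2 (n - 3) = a 4 (n - 1)"
      using anti_upper[of 2 "n - 3"] n7 by simp
    also have "\<dots> = a 2 (n - 3) + a 2 (n - 1)"
      using rec2[of 4 "n - 1"] n7 by (simp add: numeral_eq_Suc)
    finally show ?thesis
      using c[of "n - 3"] c[of "n - 1"] n7 odd_n by simp
  qed
  then show ?thesis
    using c assms by simp
qed

text \<open>By \<open>rec2\<close> the entries with even indices again obey the Steinhaus
  recurrence, so the zeros of row 2 propagate downwards.\<close>

lemma even_even_upper_zero: "1 \<le> i \<Longrightarrow> i < j \<Longrightarrow> 2 * j \<le> n \<Longrightarrow> a (2 * i) (2 * j) = 0"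
proof (induction i arbitrary: j rule: nat_induct_at_least)
  case base
  then show ?case
    using row2_even_zero[of "2 * j"] by simp
next
  case (Suc i)
  have "a (2 * Suc i) (2 * j) = a (2 * i) (2 * (j - 1)) + a (2 * i) (2 * j)"
    using rec2[of "2 * Suc i" "2 * j"] Suc by (simp add: diff_mult_distrib2)
  then show ?case
    using Suc.IH[of j] Suc.IH[of "j - 1"] Suc.prems by (cases "j - 1") auto
qed

lemma even_even_zero:
  assumes "even i" "even j" "1 \<le> i" "i \<le> n" "1 \<le> j" "j \<le> n"
  shows "a i j = 0"
proof -
  have *: "a k l = 0" if kl: "even k" "even l" "1 \<le> k" "k < l" "l \<le> n" for k l
  proof -
    obtain k' l' where "k = 2 * k'" "l = 2 * l'"
      using kl by (elim evenE)
    then show ?thesis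
      using even_even_upper_zero[of k' l'] kl by auto
  qed
  show ?thesis
    using *[of i j] *[of j i] symm[of i j] diag[of i] assms
    by (cases i j rule: linorder_cases) auto
qed

section \<open>Degree count over the odd vertices\<close>

lemma odd_part_row1:
  assumes "3 \<le> n"
  shows "2 * (\<Sum>j\<in>{j\<in>{1..n}. odd j}. bval (a 1 j)) = d"
proof -
  let ?O = "{j\<in>{1..n}. odd j}" and ?E = "{j\<in>{1..n}. even j}"
  have "(\<Sum>j\<in>?E. bval (a 1 j)) = (\<Sum>j\<in>?O - {n}. bval (a 1 j))"
  \<comment> \<open>Each even \<open>j\<close> is matched with \<open>j - 1\<close>: the two entries
    of row 1 agree because they add up to \<open>a 2 j = 0\<close>, or for \<open>j = 2\<close>
    because both vanish. Only the odd index \<open>n\<close> is left over, and its entry is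
    0.\<close>
  proof (rule sum.reindex_bij_witness[of _ "\<lambda>j. j + 1" "\<lambda>j. j - 1"])
    fix j assume j: "j \<in> ?E"
    show "bval (a 1 (j - 1)) = bval (a 1 j)"
    proof (cases "j = 2")
      case True
      then show ?thesis
        using corner assms diag[of 1] by simp
    next
      case False
      then have "4 \<le> j"
        using j by (cases "j = 3") auto
      then have "a 1 (j - 1) + a 1 j = 0"
        using row2_even_zero[of j] rec[of 2 j] j by simp
      then show ?thesis
        by (simp add: bit_add_eq_0_iff)
    qed
  qed (use odd_n in \<open>auto elim: evenE oddE\<close>)
  also have "\<dots> = (\<Sum>j\<in>?O. bval (a 1 j))"
    by (rule sum.mono_neutral_left) (use corner assms in auto)
  finally have "(\<Sum>j\<in>?E. bval (a 1 j)) = (\<Sum>j\<in>?O. bval (a 1 j))" .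
  then show ?thesis
    using regular[of 1] sum_odd_even_split[of "\<lambda>j. bval (a 1 j)" n] assms by simp
qed

text \<open>All edges at even vertices lead to odd ones, so \<open>card ?E * d\<close> counts the
  edges between the two classes. The odd vertices have total degree
  \<open>(card ?E + 1) * d\<close>; the excess \<open>d\<close> stays inside the odd class.\<close>

lemma odd_part_total:
  "(\<Sum>i\<in>{i\<in>{1..n}. odd i}. \<Sum>j\<in>{j\<in>{1..n}. odd j}. bval (a i j)) = d"
proof -
  let ?O = "{j\<in>{1..n}. odd j}" and ?E = "{j\<in>{1..n}. even j}"
  have deg: "(\<Sum>j\<in>?O. bval (a i j)) + (\<Sum>j\<in>?E. bval (a i j)) = d" if "i \<in> {1..n}" for i
    using regular[of i] sum_odd_even_split[of "\<lambda>j. bval (a i j)" n] that by simp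
  have succ: "Suc j \<le> n" if "even j" "j \<le> n" for j
    using that odd_n by (cases "j = n") auto
  have "?O = insert 1 (Suc ` ?E)"
  proof (intro equalityI subsetI)
    fix j assume j: "j \<in> ?O"
    show "j \<in> insert 1 (Suc ` ?E)"
    proof (cases "j = 1")
      case False
      with j have "j - 1 \<in> ?E" "j = Suc (j - 1)"
        by auto
      then show ?thesis
        by blast
    qed simp
  next
    fix j assume "j \<in> insert 1 (Suc ` ?E)"
    then show "j \<in> ?O"
      using odd_pos[OF odd_n] by (auto intro: succ)
  qed
  moreover have "card (Suc ` ?E) = card ?E"
    by (rule card_image) simp
  moreover have "card (insert 1 (Suc ` ?E)) = Suc (card (Suc ` ?E))"
    by (rule card_insert_disjoint) auto
  ultimately have card: "card ?O = card ?E + 1"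
    by simp
  have "(\<Sum>i\<in>?O. \<Sum>j\<in>?E. bval (a i j)) = (\<Sum>j\<in>?E. \<Sum>i\<in>?O. bval (a j i))"
    by (subst sum.swap) (auto intro!: sum.cong simp: symm)
  also have "\<dots> = (\<Sum>j\<in>?E. d)"
  proof (rule sum.cong[OF refl])
    fix j assume j: "j \<in> ?E"
    then have "(\<Sum>i\<in>?E. bval (a j i)) = 0"
      by (simp add: even_even_zero)
    then show "(\<Sum>i\<in>?O. bval (a j i)) = d"
      using deg[of j] j by simp
  qed
  finally have E: "(\<Sum>i\<in>?O. \<Sum>j\<in>?E. bval (a i j)) = card ?E * d"
    by simp
  have "(\<Sum>i\<in>?O. (\<Sum>j\<in>?O. bval (a i j)) + (\<Sum>j\<in>?E. bval (a i j))) = (\<Sum>i\<in>?O. d)"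
    by (rule sum.cong) (use deg in auto)
  also have "\<dots> = card ?E * d + d"
    by (simp only: sum_constant of_nat_id card add_mult_distrib mult_1_left)
  finally show ?thesis
    unfolding sum.distrib E by linarith
qed

lemma degree_zero: "d = 0"
proof (cases "n = 1")
  case True
  then show ?thesis
    using regular[of 1] diag[of 1] by simp
next
  case False
  then have n3: "3 \<le> n"
    using odd_n by (cases "n = 2") (auto elim: oddE)
  let ?O = "{j\<in>{1..n}. odd j}"
  let ?r = "\<lambda>i. \<Sum>j\<in>?O. bval (a i j)"
  have rn: "?r n = ?r 1"
  proof (rule sum.reindex_bij_witness[of _ "\<lambda>j. n + 1 - j" "\<lambda>j. n + 1 - j"])
    fix j assume "j \<in> ?O"
    then show "bval (a 1 (n + 1 - j)) = bval (a n j)"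
      using anti_upper[of j n] symm[of j n] n3 by auto
  qed (use odd_n in auto)
  \<comment> \<open>Column 1 alone is enough here: rows 1 and \<open>n\<close> give
    \<open>d / 2\<close> each and the other odd rows at least \<open>d / 2\<close>, so
    \<open>d\<close> is at least \<open>3 d / 2\<close>.\<close>
  have "?r 1 \<le> (\<Sum>i\<in>?O - {1, n}. ?r i)"
  proof -
    have "?r 1 = (\<Sum>i\<in>?O - {1, n}. bval (a i 1))"
      using corner[OF n3] diag[of 1] n3 by (intro sum.mono_neutral_cong_right) (auto simp: symm)
    also have "\<dots> \<le> (\<Sum>i\<in>?O - {1, n}. ?r i)"
      using n3 by (intro sum_mono member_le_sum) auto
    finally show ?thesis .
  qed
  moreover have "d = ?r 1 + ?r n + (\<Sum>i\<in>?O - {1, n}. ?r i)"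
  proof -
    have "(\<Sum>i\<in>?O. ?r i) = (\<Sum>i\<in>?O - {1, n}. ?r i) + (\<Sum>i\<in>{1, n}. ?r i)"
      by (rule sum.subset_diff) (use n3 odd_n in auto)
    moreover have "(\<Sum>i\<in>{1, n}. ?r i) = ?r 1 + ?r n"
      using n3 by simp
    ultimately show ?thesis
      using odd_part_total by linarith
  qed
  ultimately show ?thesis
    using odd_part_row1[OF n3] rn by linarith
qed

lemma entry_zero:
  assumes "1 \<le> i" "i \<le> n" "1 \<le> j" "j \<le> n"
  shows "a i j = 0"
  using regular[of i] degree_zero assms by simp

end

end

section \<open>Transfer from matrices to graphs\<close>

lemma entry_adjacency_matrix:
  assumes "1 \<le> i" "i \<le> n" "1 \<le> j" "j \<le> n"
  shows "entry (adjacency_matrix n G) i j = (if (i, j) \<in> parcs G then 1 else 0)"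
  using assms by (simp add: entry_def adjacency_matrix_def)

lemma out_degree_eq_sum_entry:
  assumes "pair_graph G" "pverts G = {1..n}" "1 \<le> v" "v \<le> n"
  shows "out_degree (with_proj G) v = (\<Sum>j=1..n. bval (entry (adjacency_matrix n G) v j))"
proof -
  interpret pair_graph G
    by fact
  have "out_arcs (with_proj G) v = Pair v ` {j\<in>{1..n}. (v, j) \<in> parcs G}"
    using in_arcsD2 assms(2) by (force simp: out_arcs_def with_proj_def)
  then have "out_degree (with_proj G) v = card {j\<in>{1..n}. (v, j) \<in> parcs G}"
    by (simp add: out_degree_def card_image inj_on_def)
  also have "\<dots> = (\<Sum>j=1..n. if (v, j) \<in> parcs G then 1 else 0)"
    by (simp flip: sum.inter_filter)
  also have "\<dots> = (\<Sum>j=1..n. bval (entry (adjacency_matrix n G) v j))"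
    using assms by (intro sum.cong) (auto simp: entry_adjacency_matrix bval_def)
  finally show ?thesis .
qed

lemma regular_multi_symmetric_imp_zero_edge:
  assumes "odd n" "steinhaus_graph n G" "regular_graph G"
    "multi_symmetric n (adjacency_matrix n G)"
  shows "G = zero_edge_graph n"
proof -
  have G: "pair_graph G" "pverts G = {1..n}" "steinhaus_matrix n (adjacency_matrix n G)"
    using assms(2) by (auto simp: steinhaus_graph_def)
  interpret pair_graph G
    by (fact G)
  let ?a = "entry (adjacency_matrix n G)"
  have steinhaus:
    "\<forall>i\<in>{1..n}. ?a i i = 0"
    "\<forall>i j. 2 \<le> i \<and> i < j \<and> j \<le> n \<longrightarrow> ?a i j = ?a (i - 1) (j - 1) + ?a (i - 1) j"
    "\<forall>i\<in>{1..n}. \<forall>j\<in>{1..n}. ?a i j = ?a j i"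
    using G(3) unfolding steinhaus_matrix_def by - (elim conjE, assumption)+
  have symmetric:
    "\<forall>i\<in>{1..n}. \<forall>j\<in>{1..n}. ?a i j = ?a j i \<and> ?a j i = ?a (n - j + 1) (n - i + 1)"
    "\<forall>i j. 1 \<le> i \<and> i < j \<and> j \<le> n \<longrightarrow> ?a i j = ?a i (n - j + i + 1)"
    using assms(4) unfolding multi_symmetric_def doubly_symmetric_def by - (elim conjE, assumption)+
  interpret multi_symmetric_steinhaus n ?a
  proof
    fix i j :: nat
    show "odd n"
      by fact
    show "?a i i = 0" if "1 \<le> i" "i \<le> n"
      using steinhaus(1) that by (meson atLeastAtMost_iff)
    show "?a i j = ?a (i - 1) (j - 1) + ?a (i - 1) j" if "2 \<le> i" "i < j" "j \<le> n"
      using steinhaus(2) that by blast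
    show "?a i j = ?a j i" if "1 \<le> i" "i \<le> n" "1 \<le> j" "j \<le> n"
      using steinhaus(3) that by (meson atLeastAtMost_iff)
    show "?a j i = ?a (n - j + 1) (n - i + 1)" if "1 \<le> i" "i \<le> n" "1 \<le> j" "j \<le> n"
      using symmetric(1) that by (meson atLeastAtMost_iff)
    show "?a i j = ?a i (n - j + i + 1)" if "1 \<le> i" "i < j" "j \<le> n"
      using symmetric(2) that by blast
  qed
  obtain d where d: "\<And>v. v \<in> {1..n} \<Longrightarrow> out_degree (with_proj G) v = d"
    using assms(3) G(2) by (auto simp: regular_graph_def)
  have "(\<Sum>j=1..n. bval (entry (adjacency_matrix n G) v j)) = d" if "1 \<le> v" "v \<le> n" for v
    using out_degree_eq_sum_entry[OF G(1,2) that] d[of v] that by simp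
  \<comment> \<open>Row sums of the adjacency matrix are degrees, which discharges the regularity
    assumption.\<close>
  note zero = entry_zero[OF this]
  have "(i, j) \<notin> parcs G" for i j
  proof
    assume ij: "(i, j) \<in> parcs G"
    then have "i \<in> {1..n}" "j \<in> {1..n}"
      using in_arcsD1[OF ij] in_arcsD2[OF ij] G(2) by auto
    then show False
      using zero[of i j] entry_adjacency_matrix[of i n j G] ij by simp
  qed
  then have "parcs G = {}"
    by auto
  then show ?thesis
    using G(2) by (simp add: zero_edge_graph_def)
qed

lemma zero_edge_graph_regular_multi_symmetric:
  shows "steinhaus_graph n (zero_edge_graph n)" "regular_graph (zero_edge_graph n)"
    "multi_symmetric n (adjacency_matrix n (zero_edge_graph n))"
proof -
  have e: "entry (adjacency_matrix n (zero_edge_graph n)) i j = 0"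
    if "1 \<le> i" "i \<le> n" "1 \<le> j" "j \<le> n" for i j
    using that by (simp add: entry_adjacency_matrix zero_edge_graph_def)
  have c: "adjacency_matrix n (zero_edge_graph n) \<in> carrier_mat n n"
    by (simp add: adjacency_matrix_def)
  have "pair_graph (zero_edge_graph n)"
    by unfold_locales (auto simp: zero_edge_graph_def arc_to_ends_def sym_def symmetric_def)
  then show "steinhaus_graph n (zero_edge_graph n)"
    using c by (auto simp: steinhaus_graph_def steinhaus_matrix_def e) (simp add: zero_edge_graph_def)+
  show "regular_graph (zero_edge_graph n)"
    by (simp add: regular_graph_def zero_edge_graph_def out_degree_def out_arcs_def)
  show "multi_symmetric n (adjacency_matrix n (zero_edge_graph n))"
    using c by (auto simp: multi_symmetric_def doubly_symmetric_def e)
qed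

theorem theorem8:
  fixes n :: nat
  assumes "odd n"
  shows "{G. steinhaus_graph n G \<and> regular_graph G \<and> multi_symmetric n (adjacency_matrix n G)}
           = {zero_edge_graph n}"
  using regular_multi_symmetric_imp_zero_edge[OF assms]
    zero_edge_graph_regular_multi_symmetric[of n]
  by blast

end
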